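(* Let $0<d<1/2$ and let $\{Z_n\}_{n\in\mathbb{Z}}$ be a (real-valued) second-order stationary process with spectral density $f(\lambda)=\sigma^2 f_d(\lambda)$ for some constant $\sigma^2>0$, where $$f_d(\lambda)=\frac{1}{2\pi}\left|1-e^{i\lambda}\right|^{-2d},\quad \lambda\in(-\pi,\pi].$$ Then there exists a constant $c>0$ such that for all integers $b,k$ with $1\le b<k$, $$\rho_{k,b}\le c\left(\frac{b}{k-b}\right)^{1-2d},$$ where $\rho_{k,b}$ is the canonical correlation between the blocks $(Z_1,\dots,Z_b)$ and $(Z_{k+1},\dots,Z_{k+b})$.
   Context: A second-order stationary process $\{Z_n\}$ has covariance function $\gamma(n)=\mathrm{Cov}[Z_n,Z_0]$ and spectral density $f$ if $\gamma(n)=\int_{-\pi}^{\pi}f(\lambda)e^{in\lambda}\,d\lambda$ for all $n\in\mathbb{Z}$. Let $\Sigma_b=(\gamma(i_2-i_1))_{1\le i_1,i_2\le b}$ be the covariance matrix of $(Z_1,\dots,Z_b)$ (assumed non-singular for every $b$) and $\Sigma_{k,b}=(\gamma(i_2+k-i_1))_{1\le i_1,i_2\le b}$ the cross-covariance matrix between $(Z_1,\dots,Z_b)$ and $(Z_{k+1},\dots,Z_{k+b})$. The canonical correlation is $$\rho_{k,b}=\sup_{\mathbf{u},\mathbf{v}\in\mathbb{R}^b}\mathrm{Corr}\Big(\sum_{j=1}^b u_jZ_j,\ \sum_{j=1}^b v_jZ_{k+j}\Big)=\sup_{\mathbf{u},\mathbf{v}\in\mathbb{R}^b}\frac{\mathbf{u}^T\Sigma_{k,b}\mathbf{v}}{\sqrt{\mathbf{u}^T\Sigma_b\mathbf{u}}\sqrt{\mathbf{v}^T\Sigma_b\mathbf{v}}},$$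 the supremum being over nonzero $\mathbf{u},\mathbf{v}$. *)

theory Defs
  imports "HOL-Probability.Probability" "Jordan_Normal_Form.Matrix"
begin

definition covariance :: "'a measure \<Rightarrow> ('a \<Rightarrow> real) \<Rightarrow> ('a \<Rightarrow> real) \<Rightarrow> real" where
  "covariance M X Y =
     (\<integral>x. (X x - (\<integral>y. X y \<partial>M)) * (Y x - (\<integral>y. Y y \<partial>M)) \<partial>M)"

definition correlation :: "'a measure \<Rightarrow> ('a \<Rightarrow> real) \<Rightarrow> ('a \<Rightarrow> real) \<Rightarrow> real" where
  "correlation M X Y =
     covariance M X Y / (sqrt (covariance M X X) * sqrt (covariance M Y Y))"

definition autocov :: "'a measure \<Rightarrow> (int \<Rightarrow> 'a \<Rightarrow> real) \<Rightarrow> int \<Rightarrow> real" where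
  "autocov M Z n = covariance M (Z n) (Z 0)"

definition second_order_stationary :: "'a measure \<Rightarrow> (int \<Rightarrow> 'a \<Rightarrow> real) \<Rightarrow> bool" where
  "second_order_stationary M Z \<longleftrightarrow>
     prob_space M \<and>
     (\<forall>n. Z n \<in> borel_measurable M \<and> integrable M (\<lambda>x. (Z n x)\<^sup>2)) \<and>
     (\<forall>n. (\<integral>x. Z n x \<partial>M) = (\<integral>x. Z 0 x \<partial>M)) \<and>
     (\<forall>m n. covariance M (Z (m + n)) (Z m) = autocov M Z n)"

definition spectral_density ::
  "'a measure \<Rightarrow> (int \<Rightarrow> 'a \<Rightarrow> real) \<Rightarrow> (real \<Rightarrow> real) \<Rightarrow> bool" where
  "spectral_density M Z f \<longleftrightarrow>
     (\<forall>t\<in>{-pi<..pi}. 0 \<le> f t) \<and>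
     set_integrable lborel {-pi<..pi} f \<and>
     (\<forall>n. complex_of_real (autocov M Z n) =
        (CLINT t:{-pi<..pi}|lborel.
           complex_of_real (f t) * exp (\<i> * of_int n * complex_of_real t)))"

(* For d > 0 the formula is infinite at t = 0. Since 0 powr a = 0, the function below takes the
   value 0 there; a single point does not affect the integrals. *)
definition frac_density :: "real \<Rightarrow> real \<Rightarrow> real" where
  "frac_density d t = 1 / (2 * pi) * (cmod (1 - exp (\<i> * complex_of_real t))) powr (- 2 * d)"

(* Matrix and vector indices run from 0 to b - 1. *)
definition cov_mat :: "'a measure \<Rightarrow> (int \<Rightarrow> 'a \<Rightarrow> real) \<Rightarrow> nat \<Rightarrow> real mat" where
  "cov_mat M Z b = mat b b (\<lambda>(i, j). autocov M Z (int j - int i))"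

(* The linear combination of Z (s + 1), ..., Z (s + b) with coefficients u. *)
definition block_comb :: "(int \<Rightarrow> 'a \<Rightarrow> real) \<Rightarrow> int \<Rightarrow> nat \<Rightarrow> real Matrix.vec \<Rightarrow> 'a \<Rightarrow> real" where
  "block_comb Z s b u x = (\<Sum>j<b. vec_index u j * Z (s + int j + 1) x)"

(* For a square-integrable process and b > 0 the set is nonempty and bounded by 1
   (Cauchy-Schwarz), so the real-valued Sup is its least upper bound. *)
definition canonical_corr :: "'a measure \<Rightarrow> (int \<Rightarrow> 'a \<Rightarrow> real) \<Rightarrow> nat \<Rightarrow> nat \<Rightarrow> real" where
  "canonical_corr M Z k b =
     Sup {correlation M (block_comb Z 0 b u) (block_comb Z (int k) b v) | u v.
            u \<in> carrier_vec b \<and> u \<noteq> 0\<^sub>v b \<and> v \<in> carrier_vec b \<and> v \<noteq> 0\<^sub>v b}"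

end

theory Submission
  imports Defs
begin

text \<open>
  The autocovariance of \<open>Z\<close> and the Beta integrals \<open>Beta (n + d) (1 - 2 * d)\<close> satisfy the same
  first-order recursion in \<open>n\<close> as the sums \<open>S n = (\<Sum>j. a j * a (j + n))\<close>, where
  \<open>a n = pochhammer d n / fact n\<close>; hence all three are proportional. The Beta integral makes
  \<open>S n\<close> a moment sequence on \<open>[0, 1]\<close>, so the cross-covariance of the two blocks is the integral
  of \<open>r ^ (k + 1 - b) * U r * V r\<close> against a positive weight, with polynomials
  \<open>V r = (\<Sum>j<b. v j * r ^ j)\<close> and \<open>U\<close> formed likewise from the reversed \<open>u\<close>. The moving
  average form of \<open>S\<close> and the Cauchy-Schwarz inequality bound \<open>V r\<close>, uniformly in \<open>r\<close>, by a
  constant times \<open>b powr (1/2 - d)\<close> times the standard deviation of the block. The remaining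
  integral is \<open>S (k + 1 - b)\<close>, which is at most \<open>S 0 * (k - b) powr (2 * d - 1)\<close>.
\<close>

subsection \<open>The fractional covariance sequence\<close>

text \<open>The Taylor coefficients of \<open>(1 - z) powr (- x)\<close>. Negative \<open>x\<close>
  occurs too: \<open>frac_coeff d\<close> and \<open>frac_coeff (- d)\<close> are mutually inverse
  power series.\<close>

definition frac_coeff :: "real \<Rightarrow> nat \<Rightarrow> real" where
  "frac_coeff x n = pochhammer x n / fact n"

lemma frac_coeff_0 [simp]: "frac_coeff x 0 = 1"
  by (simp add: frac_coeff_def)

lemma frac_coeff_Suc: "frac_coeff x (Suc n) = (x + real n) / real (Suc n) * frac_coeff x n"
  by (simp add: frac_coeff_def pochhammer_Suc field_simps)

lemma frac_coeff_Suc_shift: "frac_coeff x (Suc n) = x / real (Suc n) * frac_coeff (x + 1) n"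
  by (simp add: frac_coeff_def pochhammer_rec field_simps)

lemma frac_coeff_gbinomial: "frac_coeff x n = (-1) ^ n * ((-x) gchoose n)"
  by (simp add: frac_coeff_def gbinomial_pochhammer)

lemma frac_coeff_nonneg: "0 \<le> x \<Longrightarrow> 0 \<le> frac_coeff x n"
  by (induction n) (simp_all add: frac_coeff_Suc)

text \<open>Taking out the leading factor \<open>- x\<close> leaves a coefficient with parameter
  \<open>1 - x\<close>, which is nonnegative.\<close>

lemma frac_coeff_nonpos:
  assumes "0 \<le> x" "x \<le> 1" "n > 0"
  shows "frac_coeff (- x) n \<le> 0"
proof -
  obtain m where n: "n = Suc m" using assms(3) by (cases n) auto
  have "0 \<le> frac_coeff (- x + 1) m" using assms by (intro frac_coeff_nonneg) auto
  then show ?thesis unfolding n frac_coeff_Suc_shift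
    using assms by (intro mult_nonpos_nonneg) (auto simp: divide_nonpos_pos)
qed

text \<open>Summation multiplies the generating function by \<open>1 / (1 - z)\<close>, which raises
  the parameter by one.\<close>

lemma frac_coeff_sum: "(\<Sum>l\<le>n. frac_coeff x l) = frac_coeff (x + 1) n"
proof (induction n)
  case (Suc n)
  then show ?case
    by (simp add: frac_coeff_Suc_shift[of x n] frac_coeff_Suc[of "x + 1" n]) (simp add: field_simps)
qed simp

text \<open>Compares coefficients in \<open>(1 - z) powr (- x) * (1 - z) powr x = 1\<close>, by
  Vandermonde's identity.\<close>

lemma frac_coeff_convolution:
  "(\<Sum>i\<le>n. frac_coeff x i * frac_coeff (- x) (n - i)) = (if n = 0 then 1 else 0)"
proof -
  have "(\<Sum>i\<le>n. frac_coeff x i * frac_coeff (- x) (n - i))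
      = (\<Sum>i=0..n. (-1) ^ n * (((-x) gchoose i) * (x gchoose (n - i))))"
  proof (intro sum.cong)
    fix i assume "i \<in> {0..n}"
    then have "(-1::real) ^ i * (-1) ^ (n - i) = (-1) ^ n"
      by (simp flip: power_add)
    then show "frac_coeff x i * frac_coeff (- x) (n - i) = (-1) ^ n * (((-x) gchoose i) * (x gchoose (n - i)))"
      by (simp add: frac_coeff_gbinomial)
  qed auto
  also have "\<dots> = (-1) ^ n * ((0::real) gchoose n)"
    using gbinomial_Vandermonde[of "-x" x n] by (simp flip: sum_distrib_left)
  also have "\<dots> = (if n = 0 then 1 else 0)" by (cases n) auto
  finally show ?thesis .
qed

text \<open>With \<open>x = Suc n\<close>, each factor satisfies
  \<open>1 - e / x \<le> exp (- e / x) \<le> (x / (x + 1)) powr e\<close>, and the last expressions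
  telescope. The decay of both \<open>frac_coeff\<close> and \<open>frac_cov\<close> comes from
  here.\<close>

lemma ratio_bound_powr:
  fixes g :: "nat \<Rightarrow> real"
  assumes e: "0 \<le> e" and nonneg: "\<And>n. 0 \<le> g n"
    and step: "\<And>n. g (Suc n) \<le> (1 - e / real (Suc n)) * g n"
  shows "g n \<le> g 0 * real (Suc n) powr (- e)"
proof (induction n)
  case (Suc n)
  define x where "x = real (Suc n)"
  have x: "x > 0" by (simp add: x_def)
  have "ln ((x + 1) / x) \<le> 1 / x"
    using x ln_add_one_self_le_self[of "1 / x"] by (simp add: add_divide_distrib)
  then have "e * ln ((x + 1) / x) \<le> e * (1 / x)"
    using e by (rule mult_left_mono)
  then have "- e / x \<le> - e * ln (x + 1) + e * ln x"
    using x by (simp add: ln_div algebra_simps)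
  then have "exp (- e / x) \<le> (x + 1) powr (- e) * x powr e"
    using x by (simp add: powr_def flip: exp_add)
  moreover have "1 - e / x \<le> exp (- e / x)"
    using exp_ge_add_one_self[of "- e / x"] by simp
  ultimately have le: "1 - e / x \<le> (x + 1) powr (- e) * x powr e" by simp
  have "g (Suc n) \<le> (1 - e / x) * g n" using step[of n] by (simp add: x_def)
  also have "\<dots> \<le> ((x + 1) powr (- e) * x powr e) * g n"
    using le nonneg by (rule mult_right_mono)
  also have "\<dots> \<le> ((x + 1) powr (- e) * x powr e) * (g 0 * x powr (- e))"
    using Suc by (intro mult_left_mono) (auto simp: x_def)
  also have "\<dots> = g 0 * (x + 1) powr (- e)"
    using x by (simp add: powr_minus)
  also have "x + 1 = real (Suc (Suc n))" by (simp add: x_def)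
  finally show ?case .
qed simp

lemma frac_coeff_le_powr:
  assumes "0 \<le> x" "x \<le> 1"
  shows "frac_coeff x n \<le> real (Suc n) powr (x - 1)"
proof -
  have "frac_coeff x n \<le> frac_coeff x 0 * real (Suc n) powr (- (1 - x))"
    using assms by (intro ratio_bound_powr frac_coeff_nonneg)
      (auto simp: frac_coeff_Suc field_simps)
  then show ?thesis by simp
qed

text \<open>
  Up to a factor, the autocovariance of the moving average with coefficients
  \<open>frac_coeff d\<close>, which are the Taylor coefficients of \<open>(1 - z) powr (- d)\<close>.
\<close>
definition frac_cov :: "real \<Rightarrow> nat \<Rightarrow> real" where
  "frac_cov d n = (\<Sum>j. frac_coeff d j * frac_coeff d (j + n))"

lemma frac_coeff_prod_le:
  assumes "0 < d" "d < 1 / 2"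
  shows "frac_coeff d j * frac_coeff d (j + n) \<le> real (Suc j) powr (2 * d - 2)"
proof -
  have "frac_coeff d (j + n) \<le> real (Suc (j + n)) powr (d - 1)"
    using assms by (intro frac_coeff_le_powr) auto
  also have "\<dots> \<le> real (Suc j) powr (d - 1)"
    using assms by (intro powr_mono2') auto
  finally have "frac_coeff d j * frac_coeff d (j + n) \<le> real (Suc j) powr (d - 1) * real (Suc j) powr (d - 1)"
    using assms by (intro mult_mono frac_coeff_le_powr frac_coeff_nonneg) auto
  then show ?thesis by (simp flip: powr_add)
qed

lemma summable_frac_coeff_prod:
  assumes "0 < d" "d < 1 / 2"
  shows "summable (\<lambda>j. frac_coeff d j * frac_coeff d (j + n))"
proof (rule summable_comparison_test)
  show "summable (\<lambda>j. real (Suc j) powr (2 * d - 2))"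
    using assms by (subst summable_Suc_iff) (simp add: summable_real_powr_iff)
  show "\<exists>N. \<forall>j\<ge>N. norm (frac_coeff d j * frac_coeff d (j + n)) \<le> real (Suc j) powr (2 * d - 2)"
    using frac_coeff_prod_le[OF assms] assms by (auto simp: abs_mult frac_coeff_nonneg)
qed

lemma frac_cov_sums:
  assumes "0 < d" "d < 1 / 2"
  shows "(\<lambda>j. frac_coeff d j * frac_coeff d (j + n)) sums frac_cov d n"
  using summable_frac_coeff_prod[OF assms] by (simp add: frac_cov_def summable_sums)

lemma frac_cov_nonneg:
  assumes "0 < d" "d < 1 / 2"
  shows "0 \<le> frac_cov d n"
  unfolding frac_cov_def
  using assms by (intro suminf_nonneg summable_frac_coeff_prod) (auto simp: frac_coeff_nonneg)

text \<open>Creative telescoping: term by term, the two sides differ by a telescoping difference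
  whose boundary terms vanish.\<close>

lemma frac_cov_Suc:
  assumes d: "0 < d" "d < 1 / 2"
  shows "(real n + 1 - d) * frac_cov d (Suc n) = (real n + d) * frac_cov d n"
proof -
  \<comment> \<open>The telescoping certificate; \<open>G 0 = 0\<close> because of the factor
    \<open>real j\<close>.\<close>
  define G where "G j = real j * (frac_coeff d j * frac_coeff d (j + n))" for j
  have tele: "(real n + 1 - d) * (frac_coeff d j * frac_coeff d (j + Suc n))
      - (real n + d) * (frac_coeff d j * frac_coeff d (j + n)) = G j - G (Suc j)" for j
  proof -
    have 1: "real (Suc (j + n)) * frac_coeff d (Suc (j + n)) = (d + real (j + n)) * frac_coeff d (j + n)"
      by (simp add: frac_coeff_Suc)
    have 2: "real (Suc j) * frac_coeff d (Suc j) = (d + real j) * frac_coeff d j"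
      by (simp add: frac_coeff_Suc)
    have "G (Suc j) = ((d + real j) * frac_coeff d j) * frac_coeff d (Suc (j + n))"
      by (simp only: G_def flip: 2) simp
    moreover have "frac_coeff d j * (real (Suc (j + n)) * frac_coeff d (Suc (j + n)))
        = frac_coeff d j * ((d + real (j + n)) * frac_coeff d (j + n))"
      by (simp only: 1)
    ultimately show ?thesis
      by (simp add: G_def algebra_simps)
  qed
  \<comment> \<open>This majorant of \<open>G\<close> has order \<open>j powr (2 * d - 1)\<close>, a
    negative power since \<open>d < 1 / 2\<close>.\<close>
  have "(\<lambda>j. real j * real (Suc j) powr (2 * d - 2)) \<longlonglongrightarrow> 0"
    using d by real_asymp
  then have "G \<longlonglongrightarrow> 0"
  proof (rule tendsto_0_le[where K = 1], intro always_eventually allI)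
    fix j
    show "norm (G j) \<le> norm (real j * real (Suc j) powr (2 * d - 2)) * 1"
      using frac_coeff_prod_le[OF d, of j n] d
      by (auto simp: G_def abs_mult frac_coeff_nonneg intro!: mult_left_mono)
  qed
  from telescope_sums'[OF this] have "(\<lambda>j. G j - G (Suc j)) sums 0"
    by (simp add: G_def)
  moreover have "(\<lambda>j. G j - G (Suc j)) sums
      ((real n + 1 - d) * frac_cov d (Suc n) - (real n + d) * frac_cov d n)"
    unfolding tele[symmetric] by (intro sums_diff sums_mult frac_cov_sums d)
  ultimately show ?thesis using sums_unique2 by fastforce
qed

text \<open>Since \<open>real n + 1 - d\<close> is positive, the recursion determines a sequence
  from its initial value.\<close>

lemma proportional_to_frac_cov:
  assumes d: "0 < d" "d < 1 / 2"
    and g: "\<And>n. (real n + 1 - d) * g (Suc n) = (real n + d) * g n"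
  shows "g n * frac_cov d 0 = g 0 * frac_cov d n"
proof (induction n)
  case (Suc n)
  have "(real n + 1 - d) * (g (Suc n) * frac_cov d 0) = (real n + d) * (g n * frac_cov d 0)"
    using g[of n] by (metis mult.assoc)
  also have "\<dots> = g 0 * ((real n + d) * frac_cov d n)" using Suc by simp
  also have "\<dots> = (real n + 1 - d) * (g 0 * frac_cov d (Suc n))"
    using frac_cov_Suc[OF d, of n] by (metis mult.left_commute)
  finally show ?case using d by simp
qed simp

lemma frac_cov_0_ge_1:
  assumes d: "0 < d" "d < 1 / 2"
  shows "1 \<le> frac_cov d 0"
proof -
  have "(\<Sum>j<1. frac_coeff d j * frac_coeff d (j + 0)) \<le> frac_cov d 0"
    unfolding frac_cov_def using d
    by (intro sum_le_suminf summable_frac_coeff_prod) (auto simp: frac_coeff_nonneg)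
  then show ?thesis by simp
qed

lemma frac_cov_le_powr:
  assumes d: "0 < d" "d < 1 / 2"
  shows "frac_cov d n \<le> frac_cov d 0 * real (Suc n) powr (2 * d - 1)"
proof -
  have "frac_cov d n \<le> frac_cov d 0 * real (Suc n) powr (- (1 - 2 * d))"
  proof (rule ratio_bound_powr)
    show "0 \<le> frac_cov d n" for n by (rule frac_cov_nonneg[OF d])
    show "frac_cov d (Suc n) \<le> (1 - (1 - 2 * d) / real (Suc n)) * frac_cov d n" for n
    proof -
      have "frac_cov d (Suc n) = (real n + d) / (real n + 1 - d) * frac_cov d n"
        using frac_cov_Suc[OF d, of n] d by (simp add: field_simps)
      also have "(real n + d) / (real n + 1 - d) = 1 - (1 - 2 * d) / (real n + 1 - d)"
        using d by (simp add: field_simps)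
      \<comment> \<open>Enlarging the denominator to \<open>Suc n\<close> weakens the decay to the
        form that \<open>ratio_bound_powr\<close> expects.\<close>
      also have "\<dots> * frac_cov d n \<le> (1 - (1 - 2 * d) / real (Suc n)) * frac_cov d n"
        using d by (intro mult_right_mono frac_cov_nonneg diff_left_mono divide_left_mono) auto
      finally show ?thesis .
    qed
  qed (use d in auto)
  then show ?thesis by simp
qed

text \<open>The identity \<open>(x + y) * Beta (x + 1) y = x * Beta x y\<close> at
  \<open>x = n + d\<close>, \<open>y = 1 - 2 * d\<close> is the recursion of
  \<open>frac_cov_Suc\<close>.\<close>

lemma frac_cov_Beta:
  assumes d: "0 < d" "d < 1 / 2"
  shows "frac_cov d n = frac_cov d 0 / Beta d (1 - 2 * d) * Beta (real n + d) (1 - 2 * d)"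
proof -
  have "Beta (real n + d) (1 - 2 * d) * frac_cov d 0 = Beta (real 0 + d) (1 - 2 * d) * frac_cov d n"
  proof (rule proportional_to_frac_cov[OF d])
    fix n
    have "real n + d \<notin> \<int>\<^sub>\<le>\<^sub>0" using d by (auto elim!: nonpos_Ints_cases)
    from Beta_plus1_left[OF this, of "1 - 2 * d"]
    show "(real n + 1 - d) * Beta (real (Suc n) + d) (1 - 2 * d) = (real n + d) * Beta (real n + d) (1 - 2 * d)"
      by (simp add: algebra_simps)
  qed
  moreover have "Beta d (1 - 2 * d) > 0"
    using d by (simp add: Beta_def Gamma_real_pos)
  ultimately show ?thesis by (simp add: field_simps)
qed

lemma frac_cov_has_integral:
  assumes d: "0 < d" "d < 1 / 2"
  shows "((\<lambda>r. frac_cov d 0 / Beta d (1 - 2 * d) * (r powr (d - 1) * (1 - r) powr (- 2 * d)) * r ^ n)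
           has_integral frac_cov d n) {0..1}"
proof -
  have "((\<lambda>r. r powr (real n + d - 1) * (1 - r) powr ((1 - 2 * d) - 1))
      has_integral Beta (real n + d) (1 - 2 * d)) {0..1}"
    using d by (intro has_integral_Beta_real) auto
  then have "((\<lambda>r. frac_cov d 0 / Beta d (1 - 2 * d) * (r powr (real n + d - 1) * (1 - r) powr ((1 - 2 * d) - 1)))
      has_integral frac_cov d 0 / Beta d (1 - 2 * d) * Beta (real n + d) (1 - 2 * d)) {0..1}"
    by (rule has_integral_mult_right)
  then show ?thesis
    unfolding frac_cov_Beta[OF d, of n]
  proof (rule has_integral_eq[rotated])
    fix r :: real assume r: "r \<in> {0..1}"
    \<comment> \<open>At \<open>r = 0\<close> both sides are zero, since \<open>0 powr a = 0\<close>
      even for negative \<open>a\<close>.\<close>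
    have "r powr (real n + d - 1) = r powr (d - 1) * r ^ n"
    proof (cases "r = 0")
      case False
      then have "r > 0" using r by simp
      then show ?thesis by (simp add: powr_realpow[symmetric] algebra_simps flip: powr_add)
    qed simp
    then show "frac_cov d 0 / Beta d (1 - 2 * d) * (r powr (real n + d - 1) * (1 - r) powr ((1 - 2 * d) - 1))
        = frac_cov d 0 / Beta d (1 - 2 * d) * (r powr (d - 1) * (1 - r) powr (- 2 * d)) * r ^ n"
      by simp
  qed
qed

subsection \<open>Generating polynomials of a block\<close>

text \<open>Partial sums of the Taylor series of \<open>(1 - r) powr d\<close>.\<close>
definition trunc_binom :: "real \<Rightarrow> nat \<Rightarrow> real \<Rightarrow> real" where
  "trunc_binom d n r = (\<Sum>l<n. frac_coeff (- d) l * r ^ l)"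

lemma trunc_binom_Suc_1: "trunc_binom d (Suc n) 1 = frac_coeff (1 - d) n"
  using frac_coeff_sum[of "- d" n] by (simp add: trunc_binom_def lessThan_Suc_atMost add.commute)

text \<open>All coefficients of positive index are nonpositive, so the partial sums decrease, and
  they decrease most at \<open>r = 1\<close>.\<close>
lemma trunc_binom_mono:
  assumes d: "0 \<le> d" "d \<le> 1" and r: "0 \<le> r" "r \<le> 1" and "m \<le> n" "0 < m"
  shows "0 \<le> trunc_binom d m r - trunc_binom d n r"
    and "trunc_binom d m r - trunc_binom d n r \<le> trunc_binom d m 1 - trunc_binom d n 1"
proof -
  have eq: "trunc_binom d m r - trunc_binom d n r = (\<Sum>l=m..<n. - frac_coeff (- d) l * r ^ l)" for r
    using sum_diff_nat_ivl[of 0 m n "\<lambda>l. frac_coeff (- d) l * r ^ l"] \<open>m \<le> n\<close>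
    by (simp add: trunc_binom_def lessThan_atLeast0 sum_negf)
  have nonneg: "0 \<le> - frac_coeff (- d) l" if "l \<in> {m..<n}" for l
    using frac_coeff_nonpos[of d l] d that \<open>0 < m\<close> by auto
  show "0 \<le> trunc_binom d m r - trunc_binom d n r"
    unfolding eq using nonneg r by (intro sum_nonneg mult_nonneg_nonneg) auto
  show "trunc_binom d m r - trunc_binom d n r \<le> trunc_binom d m 1 - trunc_binom d n 1"
    unfolding eq using nonneg r by (intro sum_mono mult_left_mono) (auto simp: power_le_one)
qed

lemma trunc_binom_tendsto:
  assumes "0 < d" "0 \<le> r" "r < 1"
  shows "(\<lambda>n. trunc_binom d n r) \<longlonglongrightarrow> (1 - r) powr d"
proof -
  have "(\<lambda>n. (d gchoose n) * (- r) ^ n) sums (1 + (- r)) powr d"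
    using assms by (intro gen_binomial_real) auto
  moreover have "(d gchoose n) * (- r) ^ n = frac_coeff (- d) n * r ^ n" for n
    by (simp add: frac_coeff_gbinomial power_minus[of r])
  ultimately show ?thesis by (simp add: sums_def trunc_binom_def)
qed

text \<open>The partial sums decrease to \<open>(1 - r) powr d\<close>, and their excess over it is
  at most the partial sum at \<open>r = 1\<close>, which is
  \<open>frac_coeff (1 - d) (n - 1)\<close>. This keeps the estimate uniform as \<open>r\<close>
  approaches 1.\<close>

lemma trunc_binom_bounds:
  assumes d: "0 < d" "d \<le> 1" and r: "0 \<le> r" "r < 1" and n: "0 < n"
  shows "0 \<le> trunc_binom d n r" and "trunc_binom d n r \<le> (1 - r) powr d + real n powr (- d)"
proof -
  note lim = trunc_binom_tendsto[of d r]
  have ev: "\<forall>\<^sub>F N in sequentially. N \<ge> n" by (rule eventually_ge_at_top)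
  have "(1 - r) powr d \<le> trunc_binom d n r"
  proof (rule tendsto_upperbound[OF lim])
    show "\<forall>\<^sub>F N in sequentially. trunc_binom d N r \<le> trunc_binom d n r"
      using ev by eventually_elim (use trunc_binom_mono(1)[of d r n] d r n in auto)
  qed (use d r in auto)
  then show "0 \<le> trunc_binom d n r" by (rule order_trans[rotated]) simp
  have one: "0 \<le> trunc_binom d (Suc N) 1" "trunc_binom d (Suc N) 1 \<le> real (Suc N) powr (- d)" for N
    using frac_coeff_nonneg[of "1 - d" N] frac_coeff_le_powr[of "1 - d" N] d
    by (auto simp: trunc_binom_Suc_1)
  have "trunc_binom d n r - real n powr (- d) \<le> (1 - r) powr d"
  proof (rule tendsto_lowerbound[OF lim])
    show "\<forall>\<^sub>F N in sequentially. trunc_binom d n r - real n powr (- d) \<le> trunc_binom d N r"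
      using ev
    proof eventually_elim
      case (elim N)
      have "trunc_binom d n r - trunc_binom d N r \<le> trunc_binom d n 1 - trunc_binom d N 1"
        using trunc_binom_mono(2)[of d r n N] d r n elim by auto
      moreover have "0 \<le> trunc_binom d N 1" "trunc_binom d n 1 \<le> real n powr (- d)"
        using one(1)[of "N - 1"] one(2)[of "n - 1"] n elim by auto
      ultimately show ?case by linarith
    qed
  qed (use d r in auto)
  then show "trunc_binom d n r \<le> (1 - r) powr d + real n powr (- d)" by simp
qed

text \<open>A discrete form of the comparison with the integral of
  \<open>x powr (e - 1)\<close>.\<close>

lemma sum_powr_le:
  assumes e: "0 < e" "e \<le> 1"
  shows "(\<Sum>n<b. real (Suc n) powr (e - 1)) \<le> real b powr e / e"
proof (induction b)
  case (Suc b)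
  define x where "x = real (Suc b)"
  have x: "x > 0" "real b = x - 1" by (auto simp: x_def)
  \<comment> \<open>Weighted AM-GM for \<open>x - 1\<close> and \<open>x\<close>; it makes the
    increment of \<open>x powr e / e\<close> at least \<open>x powr (e - 1)\<close>.\<close>
  have "(x - 1) powr e * x powr (1 - e) \<le> e * (x - 1) + (1 - e) * x"
  proof (cases "b = 0")
    case True
    then show ?thesis using e by (simp add: x_def)
  next
    case False
    then have "x - 1 > 0" using x by linarith
    then show ?thesis using e x(1) by (intro Youngs_inequality_0) auto
  qed
  also have "\<dots> = x - e" by (simp add: algebra_simps)
  finally have "(x - 1) powr e * x powr (1 - e) * x powr (e - 1) \<le> (x - e) * x powr (e - 1)"
    by (rule mult_right_mono) simp
  then have "(x - 1) powr e \<le> x powr e - e * x powr (e - 1)"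
    using x by (simp add: mult.assoc powr_diff field_simps flip: powr_add)
  then have "((x - 1) powr e + e * x powr (e - 1)) / e \<le> x powr e / e"
    using e by (intro divide_right_mono) auto
  then have "real b powr e / e + x powr (e - 1) \<le> x powr e / e"
    unfolding x(2) using e by (simp add: add_divide_distrib)
  with Suc show ?case by (simp add: x_def)
qed simp

text \<open>The geometric sum is at most \<open>1 / (1 - r)\<close> and at most \<open>b\<close>.
  Interpolating with exponents \<open>2 * d\<close> and \<open>1 - 2 * d\<close> absorbs the factor
  in front, uniformly in \<open>r\<close>.\<close>

lemma sum_power_binom_le:
  assumes d: "0 < d" "d < 1 / 2" and r: "0 \<le> r" "r < 1"
  shows "(1 - r) powr (2 * d) * (\<Sum>m<b. r ^ (2 * m)) \<le> real b powr (1 - 2 * d)"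
proof (cases "b = 0")
  case False
  define S where "S = (\<Sum>m<b. r ^ (2 * m))"
  have "(1 - r) * S = (1 - r) * (\<Sum>m<b. (r\<^sup>2) ^ m)" by (simp add: S_def power_mult)
  also have "\<dots> \<le> (1 - r\<^sup>2) * (\<Sum>m<b. (r\<^sup>2) ^ m)"
    using r by (intro mult_right_mono sum_nonneg) (auto simp: power2_eq_square mult_left_le)
  also have "\<dots> = 1 - (r\<^sup>2) ^ b" by (rule one_diff_power_eq[symmetric])
  finally have 1: "(1 - r) * S \<le> 1" using zero_le_power2 by (smt (verit) zero_le_power)
  have "(\<Sum>m<b. r ^ (2 * m)) \<le> (\<Sum>m<b. 1)"
    using r by (intro sum_mono power_le_one) auto
  then have 2: "S \<le> real b" by (simp add: S_def)
  have "r ^ (2 * 0) \<le> S"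
    unfolding S_def using False r by (intro member_le_sum) auto
  then have S: "S > 0" by simp
  have "(1 - r) powr (2 * d) * S = ((1 - r) * S) powr (2 * d) * S powr (1 - 2 * d)"
    using r S by (simp add: powr_mult mult.assoc flip: powr_add)
  also have "\<dots> \<le> 1 * real b powr (1 - 2 * d)"
    using 1 2 S r d by (intro mult_mono powr_mono2 powr_le1) auto
  finally show ?thesis by (simp add: S_def)
qed simp

text \<open>The two terms of \<open>trunc_binom_bounds\<close> are separated by
  \<open>(x + y)\<^sup>2 \<le> 2 * x\<^sup>2 + 2 * y\<^sup>2\<close>; they contribute the constants
  \<open>2\<close> and \<open>2 / (1 - 2 * d)\<close>.\<close>

lemma sum_trunc_binom_le:
  assumes d: "0 < d" "d < 1 / 2" and r: "0 \<le> r" "r < 1"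
  shows "(\<Sum>m<b. (r ^ m * trunc_binom d (b - m) r)\<^sup>2)
      \<le> (2 + 2 / (1 - 2 * d)) * real b powr (1 - 2 * d)"
proof -
  have "(\<Sum>m<b. (r ^ m * trunc_binom d (b - m) r)\<^sup>2)
      \<le> (\<Sum>m<b. 2 * ((1 - r) powr (2 * d) * r ^ (2 * m)) + 2 * real (b - m) powr (- 2 * d))"
  proof (rule sum_mono)
    fix m assume m: "m \<in> {..<b}"
    define x y where "x = (1 - r) powr d" and "y = real (b - m) powr (- d)"
    have "(trunc_binom d (b - m) r)\<^sup>2 \<le> (x + y)\<^sup>2"
      unfolding x_def y_def using trunc_binom_bounds[of d r "b - m"] m d r by (intro power_mono) auto
    also have "\<dots> \<le> 2 * x\<^sup>2 + 2 * y\<^sup>2"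
      using sum_squares_bound[of x y] by (simp add: power2_sum)
    finally have "(r ^ m)\<^sup>2 * (trunc_binom d (b - m) r)\<^sup>2 \<le> (r ^ m)\<^sup>2 * (2 * x\<^sup>2 + 2 * y\<^sup>2)"
      by (rule mult_left_mono) simp
    also have "\<dots> \<le> 2 * (x\<^sup>2 * (r ^ m)\<^sup>2) + 1 * (2 * y\<^sup>2)"
      unfolding distrib_left using r
      by (intro add_mono mult_right_mono) (auto simp: power_le_one)
    also have "x\<^sup>2 = (1 - r) powr (2 * d)"
      by (simp add: x_def power2_eq_square flip: powr_add)
    also have "y\<^sup>2 = real (b - m) powr (- 2 * d)"
      by (simp add: y_def power2_eq_square flip: powr_add)
    finally show "(r ^ m * trunc_binom d (b - m) r)\<^sup>2
        \<le> 2 * ((1 - r) powr (2 * d) * r ^ (2 * m)) + 2 * real (b - m) powr (- 2 * d)"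
      by (simp add: power_mult_distrib mult.commute flip: power_mult)
  qed
  also have "\<dots> = 2 * ((1 - r) powr (2 * d) * (\<Sum>m<b. r ^ (2 * m)))
      + 2 * (\<Sum>m<b. real (b - m) powr (- 2 * d))"
    by (simp add: sum.distrib sum_distrib_left)
  also have "(\<Sum>m<b. real (b - m) powr (- 2 * d)) = (\<Sum>n<b. real (Suc n) powr ((1 - 2 * d) - 1))"
    by (subst sum.nat_diff_reindex[symmetric]) simp
  also have "2 * ((1 - r) powr (2 * d) * (\<Sum>m<b. r ^ (2 * m))) + 2 * \<dots>
      \<le> 2 * real b powr (1 - 2 * d) + 2 * (real b powr (1 - 2 * d) / (1 - 2 * d))"
    using d r by (intro add_mono mult_left_mono sum_power_binom_le sum_powr_le) auto
  finally show ?thesis by (simp add: algebra_simps)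
qed

text \<open>The pairs with \<open>i + l < n\<close> give all terms of degree below \<open>n\<close>
  in the product of two inverse series, so only the constant term survives.\<close>

lemma sum_frac_coeff_trunc_binom:
  assumes "0 < n"
  shows "(\<Sum>i<n. frac_coeff d i * r ^ i * trunc_binom d (n - i) r) = 1"
proof -
  have "(\<Sum>i<n. frac_coeff d i * r ^ i * trunc_binom d (n - i) r)
      = (\<Sum>(i, l) \<in> {(i, l). i + l < n}. frac_coeff d i * r ^ i * (frac_coeff (- d) l * r ^ l))"
  proof -
    have "{(i, l). i + l < n} = (SIGMA i:{..<n}. {..<n - i})" by auto
    then show ?thesis by (simp add: sum.Sigma[symmetric] trunc_binom_def sum_distrib_left)
  qed
  also have "\<dots> = (\<Sum>k<n. \<Sum>i\<le>k. frac_coeff d i * r ^ i * (frac_coeff (- d) (k - i) * r ^ (k - i)))"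
    by (rule sum.triangle_reindex)
  also have "\<dots> = (\<Sum>k<n. r ^ k * (\<Sum>i\<le>k. frac_coeff d i * frac_coeff (- d) (k - i)))"
  proof (intro sum.cong refl, subst sum_distrib_left, intro sum.cong refl)
    fix k i :: nat assume "i \<in> {..k}"
    then have "r ^ k = r ^ i * r ^ (k - i)" by (simp flip: power_add)
    then show "frac_coeff d i * r ^ i * (frac_coeff (- d) (k - i) * r ^ (k - i))
        = r ^ k * (frac_coeff d i * frac_coeff (- d) (k - i))" by simp
  qed
  also have "\<dots> = (\<Sum>k<n. if k = 0 then 1 else 0)"
    by (intro sum.cong) (auto simp: frac_coeff_convolution)
  also have "\<dots> = 1" using assms by (simp add: sum.delta)
  finally show ?thesis .
qed

section \<open>Block variances and evaluation of block polynomials\<close>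

definition cov_form :: "real \<Rightarrow> nat \<Rightarrow> (nat \<Rightarrow> real) \<Rightarrow> real" where
  "cov_form d b v = (\<Sum>i<b. \<Sum>j<b. v i * v j * frac_cov d (nat \<bar>int i - int j\<bar>))"

definition filt :: "real \<Rightarrow> nat \<Rightarrow> (nat \<Rightarrow> real) \<Rightarrow> nat \<Rightarrow> real" where
  "filt d b v m = (\<Sum>i<b. v i * (if i \<le> m then frac_coeff d (m - i) else 0))"

text \<open>Terms with \<open>m < max i j\<close> vanish; shifting past them leaves the defining
  series at lag \<open>|i - j|\<close>.\<close>

lemma frac_cov_sums_shifted:
  assumes d: "0 < d" "d < 1 / 2"
  shows "(\<lambda>m. (if i \<le> m then frac_coeff d (m - i) else 0) * (if j \<le> m then frac_coeff d (m - j) else 0))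
    sums frac_cov d (nat \<bar>int i - int j\<bar>)"
proof -
  have *: "(\<lambda>m. (if i \<le> m then frac_coeff d (m - i) else 0) * (if j \<le> m then frac_coeff d (m - j) else 0))
    sums frac_cov d (j - i)" (is "?f sums _") if "i \<le> j" for i j
  proof -
    have "(\<lambda>m. ?f (m + j)) sums frac_cov d (j - i)"
      using frac_cov_sums[OF d, of "j - i"] that by (simp add: mult.commute)
    moreover have "(\<Sum>m<j. ?f m) = 0" by (intro sum.neutral) auto
    ultimately show ?thesis using sums_iff_shift'[of ?f j "frac_cov d (j - i)"] by simp
  qed
  show ?thesis
  proof (cases "i \<le> j")
    case True
    then have "nat \<bar>int i - int j\<bar> = j - i" by auto
    then show ?thesis using *[OF True] by (simp only:)
  next
    case False
    then have "nat \<bar>int i - int j\<bar> = i - j" by auto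
    then show ?thesis using *[of j i] False by (simp only: mult.commute)
  qed
qed

text \<open>Expanding the square turns the quadratic form into a squared l2 norm, which gives
  nonnegativity and prepares Cauchy-Schwarz.\<close>

lemma filt_sums:
  assumes d: "0 < d" "d < 1 / 2"
  shows "(\<lambda>m. (filt d b v m)\<^sup>2) sums cov_form d b v"
proof -
  have "(\<lambda>m. \<Sum>i<b. \<Sum>j<b. v i * v j * ((if i \<le> m then frac_coeff d (m - i) else 0) * (if j \<le> m then frac_coeff d (m - j) else 0)))
      sums cov_form d b v"
    unfolding cov_form_def by (intro sums_sum sums_mult frac_cov_sums_shifted d)
  also have "(\<lambda>m. \<Sum>i<b. \<Sum>j<b. v i * v j * ((if i \<le> m then frac_coeff d (m - i) else 0) * (if j \<le> m then frac_coeff d (m - j) else 0)))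
     = (\<lambda>m. (filt d b v m)\<^sup>2)"
    unfolding filt_def power2_eq_square sum_product by (intro ext sum.cong refl) (simp only: mult_ac)
  finally show ?thesis .
qed

lemma cov_form_nonneg:
  assumes "0 < d" "d < 1 / 2"
  shows "0 \<le> cov_form d b v"
  by (rule sums_le[OF _ sums_zero filt_sums[OF assms]]) simp

text \<open>The filtered sequence is \<open>v\<close> times \<open>(1 - z) powr (- d)\<close>; undoing the filter costs a factor
  \<open>(1 - z) powr d\<close>, truncated because \<open>v\<close> has length \<open>b\<close>.\<close>
lemma generating_sum_eq:
  "(\<Sum>j<b. v j * r ^ j) = (\<Sum>m<b. filt d b v m * (r ^ m * trunc_binom d (b - m) r))"
proof -
  have "(\<Sum>m<b. filt d b v m * (r ^ m * trunc_binom d (b - m) r))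
      = (\<Sum>i<b. v i * (\<Sum>m<b. (if i \<le> m then frac_coeff d (m - i) else 0) * r ^ m * trunc_binom d (b - m) r))"
    unfolding filt_def sum_distrib_right sum_distrib_left
    by (subst sum.swap) (simp add: mult.assoc)
  also have "\<dots> = (\<Sum>i<b. v i * r ^ i)"
  proof (intro sum.cong refl)
    fix i assume i: "i \<in> {..<b}"
    have "(\<Sum>m<b. (if i \<le> m then frac_coeff d (m - i) else 0) * r ^ m * trunc_binom d (b - m) r)
        = (\<Sum>m=i..<b. frac_coeff d (m - i) * r ^ m * trunc_binom d (b - m) r)"
      by (intro sum.mono_neutral_cong_right) auto
    also have "\<dots> = (\<Sum>n<b - i. frac_coeff d n * r ^ (n + i) * trunc_binom d (b - i - n) r)"
      using i by (intro sum.reindex_bij_witness[of _ "\<lambda>n. n + i" "\<lambda>m. m - i"]) auto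
    also have "\<dots> = r ^ i * (\<Sum>n<b - i. frac_coeff d n * r ^ n * trunc_binom d (b - i - n) r)"
      by (simp add: sum_distrib_left power_add mult_ac)
    also have "\<dots> = r ^ i" using i by (subst sum_frac_coeff_trunc_binom) auto
    finally show "v i * (\<Sum>m<b. (if i \<le> m then frac_coeff d (m - i) else 0) * r ^ m * trunc_binom d (b - m) r)
        = v i * r ^ i" by simp
  qed
  finally show ?thesis ..
qed

text \<open>Cauchy-Schwarz in \<open>generating_sum_eq\<close>; the first \<open>b\<close> squares
  of \<open>filt\<close> sum to at most the whole series \<open>cov_form\<close>.\<close>

lemma generating_sum_bound:
  assumes d: "0 < d" "d < 1 / 2" and r: "0 \<le> r" "r < 1"
  shows "(\<Sum>j<b. v j * r ^ j)\<^sup>2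
     \<le> (2 + 2 / (1 - 2 * d)) * real b powr (1 - 2 * d) * cov_form d b v"
proof -
  have "(\<Sum>j<b. v j * r ^ j)\<^sup>2
      \<le> (\<Sum>m<b. (filt d b v m)\<^sup>2) * (\<Sum>m<b. (r ^ m * trunc_binom d (b - m) r)\<^sup>2)"
    unfolding generating_sum_eq[of v r b d] by (rule Cauchy_Schwarz_ineq_sum)
  also have "\<dots> \<le> cov_form d b v * ((2 + 2 / (1 - 2 * d)) * real b powr (1 - 2 * d))"
  proof (rule mult_mono)
    show "(\<Sum>m<b. (filt d b v m)\<^sup>2) \<le> cov_form d b v"
      using sum_le_suminf[OF sums_summable[OF filt_sums[OF d]]] sums_unique[OF filt_sums[OF d]] by simp
  qed (use sum_trunc_binom_le[OF d r] cov_form_nonneg[OF d] in \<open>auto intro: sum_nonneg\<close>)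
  finally show ?thesis by (simp add: mult_ac)
qed

text \<open>Reversal preserves \<open>|i - j|\<close>. This is needed because the first block enters
  the moment integral with reversed coefficients.\<close>

lemma cov_form_rev: "cov_form d b (\<lambda>i. v (b - Suc i)) = cov_form d b v"
proof -
  have "cov_form d b (\<lambda>i. v (b - Suc i))
      = (\<Sum>i<b. \<Sum>j<b. v (b - Suc i) * v (b - Suc j) * frac_cov d (nat \<bar>int (b - Suc i) - int (b - Suc j)\<bar>))"
    unfolding cov_form_def
    by (intro sum.cong refl) (simp add: of_nat_diff Suc_le_eq abs_minus_commute)
  also have "\<dots> = (\<Sum>i<b. \<Sum>j<b. v (b - Suc i) * v j * frac_cov d (nat \<bar>int (b - Suc i) - int j\<bar>))"
    by (intro sum.cong refl sum.nat_diff_reindex)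
  also have "\<dots> = cov_form d b v"
    unfolding cov_form_def by (rule sum.nat_diff_reindex)
  finally show ?thesis .
qed

text \<open>The weight is nonnegative, so uniform bounds on the two polynomials leave a single
  moment, at the smallest lag that occurs, \<open>k + 1 - b\<close>.\<close>

lemma cross_form_bound:
  assumes d: "0 < d" "d < 1 / 2" and bk: "b < k"
  shows "\<bar>\<Sum>i<b. \<Sum>j<b. u i * v j * frac_cov d (k + j - i)\<bar>
    \<le> (2 + 2 / (1 - 2 * d)) * frac_cov d 0 * (real b / (real k - real b)) powr (1 - 2 * d)
      * (sqrt (cov_form d b u) * sqrt (cov_form d b v))"
proof -
  define K where "K = (2 + 2 / (1 - 2 * d)) * real b powr (1 - 2 * d)"
  define B where "B = K * (sqrt (cov_form d b u) * sqrt (cov_form d b v))"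
  define w where "w r = frac_cov d 0 / Beta d (1 - 2 * d) * (r powr (d - 1) * (1 - r) powr (- 2 * d))" for r
  define U where "U r = (\<Sum>i<b. u (b - Suc i) * r ^ i)" for r :: real
  define V where "V r = (\<Sum>j<b. v j * r ^ j)" for r :: real
  have K: "K \<ge> 0" using d by (simp add: K_def)
  have w: "w r \<ge> 0" for r
    using d frac_cov_nonneg[OF d, of 0] by (auto simp: w_def Beta_def Gamma_real_pos less_imp_le)
  have int: "((\<lambda>r. w r * r ^ n) has_integral frac_cov d n) {0..1}" for n
    using frac_cov_has_integral[OF d, of n] by (simp add: w_def)
  \<comment> \<open>The exponent splits as \<open>k + j - i = (k + 1 - b) + (b - 1 - i) + j\<close>.\<close>
  have int1: "((\<lambda>r. w r * r ^ (k + 1 - b) * (U r * V r)) has_integral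
      (\<Sum>i<b. \<Sum>j<b. u i * v j * frac_cov d (k + j - i))) {0..1}"
  proof (rule has_integral_eq)
    show "((\<lambda>r. \<Sum>i<b. \<Sum>j<b. u i * v j * (w r * r ^ (k + j - i))) has_integral
      (\<Sum>i<b. \<Sum>j<b. u i * v j * frac_cov d (k + j - i))) {0..1}"
      by (intro has_integral_sum has_integral_mult_right int) auto
    fix r :: real
    have "U r = (\<Sum>i<b. u (b - Suc i) * r ^ (b - Suc (b - Suc i)))"
      unfolding U_def by (intro sum.cong) auto
    also have "\<dots> = (\<Sum>i<b. u i * r ^ (b - Suc i))"
      by (rule sum.nat_diff_reindex)
    finally have U: "U r = (\<Sum>i<b. u i * r ^ (b - Suc i))" .
    have "r ^ (k + j - i) = r ^ (k + 1 - b) * (r ^ (b - Suc i) * r ^ j)" if "i < b" for i j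
      using that bk by (simp flip: power_add)
    then show "(\<Sum>i<b. \<Sum>j<b. u i * v j * (w r * r ^ (k + j - i))) = w r * r ^ (k + 1 - b) * (U r * V r)"
      unfolding U V_def sum_product by (simp add: sum_distrib_left mult_ac)
  qed
  have int2: "((\<lambda>r. w r * r ^ (k + 1 - b) * B) has_integral frac_cov d (k + 1 - b) * B) {0..1}"
    by (intro has_integral_mult_left int)
  have bound: "\<bar>w r * r ^ (k + 1 - b) * (U r * V r)\<bar> \<le> w r * r ^ (k + 1 - b) * B" if r: "r \<in> {0..1}" for r
  proof (cases "r = 1")
    \<comment> \<open>\<open>generating_sum_bound\<close> excludes \<open>r = 1\<close>; there the
      weight is zero because \<open>0 powr a = 0\<close>.\<close>
    case True
    then show ?thesis using d by (simp add: w_def)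
  next
    case False
    have "\<bar>U r\<bar> \<le> sqrt (K * cov_form d b u)" "\<bar>V r\<bar> \<le> sqrt (K * cov_form d b v)"
      using generating_sum_bound[OF d, of r "\<lambda>i. u (b - Suc i)" b] generating_sum_bound[OF d, of r v b] r False
      by (auto simp: U_def V_def K_def cov_form_rev intro!: real_le_rsqrt)
    then have "\<bar>U r\<bar> * \<bar>V r\<bar> \<le> sqrt (K * cov_form d b u) * sqrt (K * cov_form d b v)"
      by (intro mult_mono) (use K cov_form_nonneg[OF d] in auto)
    also have "\<dots> = B" using K by (simp add: B_def real_sqrt_mult)
    finally show ?thesis using r w[of r]
      by (simp add: abs_mult mult_left_mono)
  qed
  let ?I = "\<Sum>i<b. \<Sum>j<b. u i * v j * frac_cov d (k + j - i)"
  have "?I \<le> frac_cov d (k + 1 - b) * B"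
    using bound by (intro has_integral_le[OF int1 int2]) (meson abs_le_D1)
  moreover have "- ?I \<le> frac_cov d (k + 1 - b) * B"
    using bound by (intro has_integral_le[OF has_integral_neg[OF int1] int2]) (meson abs_le_D2)
  ultimately have "\<bar>?I\<bar> \<le> frac_cov d (k + 1 - b) * B" by simp
  also have "\<dots> \<le> (frac_cov d 0 * (real k - real b) powr (2 * d - 1)) * B"
  proof (rule mult_right_mono)
    show "0 \<le> B" using K cov_form_nonneg[OF d] by (auto simp: B_def)
    have "frac_cov d (k + 1 - b) \<le> frac_cov d 0 * real (Suc (k + 1 - b)) powr (2 * d - 1)"
      by (rule frac_cov_le_powr[OF d])
    \<comment> \<open>The exponent is negative, so lowering the base from \<open>k - b + 2\<close>
      to \<open>k - b\<close> enlarges the bound.\<close>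
    also have "\<dots> \<le> frac_cov d 0 * (real k - real b) powr (2 * d - 1)"
      using bk d frac_cov_nonneg[OF d] by (intro mult_left_mono powr_mono2') (auto simp: of_nat_diff)
    finally show "frac_cov d (k + 1 - b) \<le> frac_cov d 0 * (real k - real b) powr (2 * d - 1)" .
  qed
  also have "(real k - real b) powr (2 * d - 1) * real b powr (1 - 2 * d) = (real b / (real k - real b)) powr (1 - 2 * d)"
    using bk powr_minus_divide[of "real k - real b" "1 - 2 * d"] by (simp add: powr_divide)
  then have "(frac_cov d 0 * (real k - real b) powr (2 * d - 1)) * B
     = (2 + 2 / (1 - 2 * d)) * frac_cov d 0 * (real b / (real k - real b)) powr (1 - 2 * d)
      * (sqrt (cov_form d b u) * sqrt (cov_form d b v))"
    by (simp add: B_def K_def mult_ac)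
  finally show ?thesis .
qed

subsection \<open>Covariances of the process\<close>

lemma cmod_one_minus_exp: "cmod (1 - exp (\<i> * complex_of_real t)) = sqrt (2 - 2 * cos t)"
proof -
  have "(1 - cos t)\<^sup>2 + (sin t)\<^sup>2 = 2 - 2 * cos t"
    using sin_cos_squared_add[of t] by (simp add: power2_diff)
  then show ?thesis by (simp add: cmod_def Re_exp Im_exp)
qed

lemma frac_density_eq: "frac_density d t = 1 / (2 * pi) * (2 - 2 * cos t) powr (- d)"
proof -
  have "sqrt (2 - 2 * cos t) powr (- 2 * d) = (2 - 2 * cos t) powr (- d)"
    by (simp add: powr_half_sqrt[symmetric] powr_powr)
  then show ?thesis by (simp add: frac_density_def cmod_one_minus_exp)
qed

lemma cos_less_1:
  assumes "-pi \<le> t" "t \<le> pi" "t \<noteq> 0"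
  shows "cos t < 1"
proof -
  have "cos \<bar>t\<bar> < cos 0" using assms by (intro cos_monotone_0_pi) auto
  then show ?thesis by simp
qed

text \<open>The spectral counterpart of \<open>frac_cov_Suc\<close>: away from 0 the integrand is
  the derivative of a function vanishing at both endpoints.\<close>

lemma cos_moment_has_integral_0:
  fixes d :: real and n :: nat
  assumes d: "d < 1 / 2"
  shows "((\<lambda>t. (2 - 2 * cos t) powr (- d) *
      ((real n + 1 - d) * cos (real (Suc n) * t) - (real n + d) * cos (real n * t))) has_integral 0) {-pi..pi}"
proof -
  define q where "q t = 2 - 2 * cos t" for t :: real
  define s where "s t = sin (real (Suc n) * t) - sin (real n * t)" for t :: real
  \<comment> \<open>Since \<open>q t\<close> is the square of \<open>2 sin (t/2)\<close> and \<open>s t\<close> has the factor \<open>2 sin (t/2)\<close>, \<open>F\<close> vanishes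
     continuously at the singularity; \<open>s\<close> also vanishes at both endpoints.\<close>
  define F where "F t = q t powr (- d) * s t" for t
  define f where "f t = q t powr (- d) *
      ((real n + 1 - d) * cos (real (Suc n) * t) - (real n + d) * cos (real n * t))" for t
  have qpos: "q t > 0" if "t \<in> {-pi..pi}" "t \<noteq> 0" for t
    using cos_less_1[of t] that by (auto simp: q_def)
  have q0: "q t \<ge> 0" for t by (simp add: q_def)
  have deriv: "(F has_field_derivative f t) (at t)" if t: "t \<in> {-pi..pi}" "t \<noteq> 0" for t
  proof -
    have qt: "q t > 0" by (rule qpos[OF t])
    have q': "(q has_field_derivative 2 * sin t) (at t)"
      unfolding q_def by (auto intro!: derivative_eq_intros)
    have s': "(s has_field_derivative (real (Suc n) * cos (real (Suc n) * t) - real n * cos (real n * t))) (at t)"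
      unfolding s_def by (auto intro!: derivative_eq_intros)
    have p': "((\<lambda>t. q t powr (- d)) has_field_derivative (- d) * q t powr (- d - 1) * (2 * sin t)) (at t)"
      using has_real_derivative_powr[OF qt, of "- d"] q' by (rule DERIV_chain2)
    \<comment> \<open>This identity supplies the factor \<open>q t\<close> that restores
      \<open>q t powr (- d)\<close> from the power \<open>- d - 1\<close> produced by
      differentiation.\<close>
    have trig: "2 * sin t * s t = q t * (cos (real (Suc n) * t) + cos (real n * t))"
    proof -
      define x where "x = real n * t"
      have sx: "s t = sin x * cos t + cos x * sin t - sin x"
        by (simp add: s_def x_def distrib_right sin_add algebra_simps)
      have cx: "cos (real (Suc n) * t) = cos x * cos t - sin x * sin t"
        by (simp add: x_def distrib_right cos_add algebra_simps)
      have "sin t * sin t = 1 - cos t * cos t"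
        using sin_cos_squared_add[of t] by (simp add: power2_eq_square)
      moreover have "2 * sin t * (sin x * cos t + cos x * sin t - sin x)
          = 2 * cos x * (sin t * sin t) + 2 * sin t * sin x * (cos t - 1)"
        by (simp add: algebra_simps)
      ultimately have "2 * sin t * s t
          = 2 * cos x * (1 - cos t * cos t) + 2 * sin t * sin x * (cos t - 1)"
        by (simp only: sx)
      then show ?thesis
        unfolding cx q_def x_def[symmetric] by (simp add: algebra_simps)
    qed
    have "q t powr (- d - 1) * q t = q t powr (- d)"
      using qt by (simp add: powr_diff)
    then have "(- d) * q t powr (- d - 1) * (2 * sin t) * s t = - d * q t powr (- d) * (cos (real (Suc n) * t) + cos (real n * t))"
      using trig by (metis (no_types, lifting) mult.assoc)
    then have "(- d) * q t powr (- d - 1) * (2 * sin t) * s t + 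
        (real (Suc n) * cos (real (Suc n) * t) - real n * cos (real n * t)) * q t powr (- d) = f t"
      by (simp add: f_def algebra_simps)
    with DERIV_mult[OF p' s'] show ?thesis by (simp add: F_def[abs_def])
  qed
  have cont0: "isCont F 0"
  proof -
    have "continuous_on UNIV (\<lambda>t. q t powr (1 / 2 - d))"
      using d q0 by (intro continuous_on_powr') (auto simp: q_def intro!: continuous_intros)
    then have "isCont (\<lambda>t. q t powr (1 / 2 - d)) 0"
      by (simp add: continuous_on_eq_continuous_at)
    then have "(\<lambda>t. q t powr (1 / 2 - d)) \<midarrow>0\<rightarrow> 0"
      by (simp add: isCont_def q_def)
    then have "F \<midarrow>0\<rightarrow> 0"
    proof (rule tendsto_0_le[where K = 1], intro always_eventually allI)
      fix t
      \<comment> \<open>Bounds \<open>s\<close> by the square root of \<open>q\<close>, so that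
        \<open>F\<close> is dominated by a positive power of \<open>q\<close>.\<close>
      have "\<bar>s t\<bar> = \<bar>2 * sin (t / 2)\<bar> * \<bar>cos ((real (Suc n) * t + real n * t) / 2)\<bar>"
        unfolding s_def sin_diff_sin by (simp add: algebra_simps abs_mult)
      also have "\<dots> \<le> \<bar>2 * sin (t / 2)\<bar> * 1" by (intro mult_left_mono) auto
      also have "\<dots> = sqrt ((2 * sin (t / 2))\<^sup>2)" by (simp only: real_sqrt_abs mult_1_right)
      also have "(2 * sin (t / 2))\<^sup>2 = q t"
        using cos_double_sin[of "t / 2"] by (simp add: q_def)
      also have "sqrt (q t) = q t powr (1 / 2)" using q0 by (simp add: powr_half_sqrt)
      finally have "q t powr (- d) * \<bar>s t\<bar> \<le> q t powr (- d) * q t powr (1 / 2)"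
        by (rule mult_left_mono) simp
      then show "norm (F t) \<le> norm (q t powr (1 / 2 - d)) * 1"
        by (simp add: F_def abs_mult flip: powr_add)
    qed
    then show ?thesis by (simp add: isCont_def F_def s_def)
  qed
  have "isCont F t" if "t \<in> {-pi..pi}" for t
    using cont0 DERIV_isCont[OF deriv[OF that]] by (cases "t = 0") auto
  then have "continuous_on {-pi..pi} F"
    by (intro continuous_at_imp_continuous_on) auto
  \<comment> \<open>The exceptional set is the point 0, where continuity of \<open>F\<close>
    suffices.\<close>
  then have "(f has_integral (F pi - F (-pi))) {-pi..pi}"
    using deriv
    by (intro fundamental_theorem_of_calculus_interior_strong[where S = "{0}"])
      (auto simp: has_real_derivative_iff_has_vector_derivative)
  moreover have "F pi = 0" "F (- pi) = 0"
    using sin_npi[of "Suc n"] sin_npi[of n] by (simp_all add: F_def s_def)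
  ultimately show ?thesis by (simp add: f_def[abs_def] q_def)
qed

text \<open>The exponential has modulus one, so integrability is inherited from \<open>f\<close>;
  then real parts are taken.\<close>

lemma autocov_integral:
  assumes "spectral_density M Z f"
  shows "set_integrable lborel {-pi<..pi} (\<lambda>t. f t * cos (real_of_int n * t))"
    and "autocov M Z n = (LINT t:{-pi<..pi}|lborel. f t * cos (real_of_int n * t))"
proof -
  let ?g = "\<lambda>t. indicator {-pi<..pi} t *\<^sub>R (complex_of_real (f t) * exp (\<i> * of_int n * complex_of_real t))"
  have f: "integrable lborel (\<lambda>t. indicator {-pi<..pi} t *\<^sub>R f t)"
    using assms by (simp add: spectral_density_def set_integrable_def)
  have eq: "?g = (\<lambda>t. complex_of_real (indicator {-pi<..pi} t *\<^sub>R f t) * exp (\<i> * of_int n * complex_of_real t))"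
    by (auto simp: fun_eq_iff indicator_def)
  have g: "integrable lborel ?g"
    unfolding eq
  proof (rule Bochner_Integration.integrable_bound[OF f])
    show "(\<lambda>t. complex_of_real (indicator {-pi<..pi} t *\<^sub>R f t) * exp (\<i> * of_int n * complex_of_real t)) \<in> borel_measurable lborel"
    proof (intro borel_measurable_times)
      show "(\<lambda>t. complex_of_real (indicator {-pi<..pi} t *\<^sub>R f t)) \<in> borel_measurable lborel"
        by (rule measurable_compose[OF borel_measurable_integrable[OF f]]) simp
      show "(\<lambda>t. exp (\<i> * of_int n * complex_of_real t)) \<in> borel_measurable lborel"
        by (auto intro!: borel_measurable_continuous_onI continuous_intros)
    qed
  qed (simp add: norm_mult norm_exp_eq_Re)
  have Re_g: "Re (?g t) = indicator {-pi<..pi} t *\<^sub>R (f t * cos (real_of_int n * t))" for t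
    by (simp add: Re_exp indicator_def)
  show "set_integrable lborel {-pi<..pi} (\<lambda>t. f t * cos (real_of_int n * t))"
    using integrable_Re[OF g] unfolding Re_g set_integrable_def .
  have "complex_of_real (autocov M Z n) = integral\<^sup>L lborel ?g"
    using assms by (simp add: spectral_density_def set_lebesgue_integral_def)
  then have "autocov M Z n = Re (integral\<^sup>L lborel ?g)" by (metis Re_complex_of_real)
  also have "\<dots> = (LINT t:{-pi<..pi}|lborel. f t * cos (real_of_int n * t))"
    unfolding set_lebesgue_integral_def integral_Re[OF g, symmetric] Re_g ..
  finally show "autocov M Z n = (LINT t:{-pi<..pi}|lborel. f t * cos (real_of_int n * t))" .
qed

lemma autocov_frac_recursion:
  fixes n :: nat
  assumes d: "d < 1 / 2" and sd: "spectral_density M Z (\<lambda>t. sigma2 * frac_density d t)"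
  shows "(real n + 1 - d) * autocov M Z (int (Suc n)) = (real n + d) * autocov M Z (int n)"
proof -
  let ?f = "\<lambda>t. sigma2 * frac_density d t"
  let ?h = "\<lambda>t. (real n + 1 - d) * (?f t * cos (real_of_int (int (Suc n)) * t))
      - (real n + d) * (?f t * cos (real_of_int (int n) * t))"
  note int = autocov_integral(1)[OF sd]
  have h: "set_integrable lborel {-pi<..pi} ?h"
    by (intro set_integral_diff set_integrable_mult_right int)
  have "(LINT t:{-pi<..pi}|lborel. ?h t)
      = (real n + 1 - d) * autocov M Z (int (Suc n)) - (real n + d) * autocov M Z (int n)"
    unfolding autocov_integral(2)[OF sd]
    using set_integral_diff(2)[OF set_integrable_mult_right[OF int] set_integrable_mult_right[OF int]]
    by (simp only: set_integral_mult_right)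
  moreover have "(LINT t:{-pi<..pi}|lborel. ?h t) = 0"
  proof -
    have "(?h has_integral (sigma2 / (2 * pi)) * 0) {-pi..pi}"
      by (rule has_integral_eq[OF _ has_integral_mult_right[OF cos_moment_has_integral_0[OF d, of n], of "sigma2 / (2 * pi)"]])
        (simp add: frac_density_eq algebra_simps add_divide_distrib diff_divide_distrib)
    \<comment> \<open>The closed and half-open intervals differ only in the null set
      \<open>{-pi}\<close>.\<close>
    then have "(?h has_integral 0) {-pi<..pi}"
      by (subst has_integral_spike_set_eq[of _ "{-pi..pi}"])
        (auto intro: negligible_subset[of "{-pi}"])
    then show ?thesis
      using set_borel_integral_eq_integral(2)[OF h] by (simp add: integral_unique)
  qed
  ultimately show ?thesis by simp
qed

section \<open>Bilinearity of covariance and correlations between blocks\<close>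

lemma integrable_mult_square:
  fixes X Y :: "'a \<Rightarrow> real"
  assumes [measurable]: "X \<in> borel_measurable M" "Y \<in> borel_measurable M"
    and "integrable M (\<lambda>x. (X x)\<^sup>2)" "integrable M (\<lambda>x. (Y x)\<^sup>2)"
  shows "integrable M (\<lambda>x. X x * Y x)"
proof (rule Bochner_Integration.integrable_bound)
  show "integrable M (\<lambda>x. (X x)\<^sup>2 + (Y x)\<^sup>2)" using assms by simp
  show "AE x in M. norm (X x * Y x) \<le> norm ((X x)\<^sup>2 + (Y x)\<^sup>2)"
  proof (intro AE_I2)
    fix x
    have "2 * \<bar>X x\<bar> * \<bar>Y x\<bar> \<le> (X x)\<^sup>2 + (Y x)\<^sup>2"
      using sum_squares_bound[of "\<bar>X x\<bar>" "\<bar>Y x\<bar>"] by simp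
    moreover have "0 \<le> \<bar>X x\<bar> * \<bar>Y x\<bar>" by simp
    ultimately have "\<bar>X x\<bar> * \<bar>Y x\<bar> \<le> (X x)\<^sup>2 + (Y x)\<^sup>2" by linarith
    then show "norm (X x * Y x) \<le> norm ((X x)\<^sup>2 + (Y x)\<^sup>2)"
      by (simp add: abs_mult)
  qed
qed measurable

lemma covariance_sum:
  fixes X Y :: "'i \<Rightarrow> 'a \<Rightarrow> real"
  assumes M: "prob_space M"
    and X: "\<And>i. X i \<in> borel_measurable M" "\<And>i. integrable M (\<lambda>x. (X i x)\<^sup>2)"
    and Y: "\<And>i. Y i \<in> borel_measurable M" "\<And>i. integrable M (\<lambda>x. (Y i x)\<^sup>2)"
  shows "covariance M (\<lambda>x. \<Sum>i\<in>A. u i * X i x) (\<lambda>x. \<Sum>j\<in>B. v j * Y j x)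
    = (\<Sum>i\<in>A. \<Sum>j\<in>B. u i * v j * covariance M (X i) (Y j))"
proof -
  interpret prob_space M by (rule M)
  define X' where "X' i x = X i x - (\<integral>y. X i y \<partial>M)" for i x
  define Y' where "Y' i x = Y i x - (\<integral>y. Y i y \<partial>M)" for i x
  have iX: "integrable M (X i)" and iY: "integrable M (Y i)" for i
    using X Y by (auto intro: square_integrable_imp_integrable)
  have X': "X' i \<in> borel_measurable M" "integrable M (\<lambda>x. (X' i x)\<^sup>2)" for i
    unfolding X'_def[abs_def] power2_diff using X iX by auto
  have Y': "Y' i \<in> borel_measurable M" "integrable M (\<lambda>x. (Y' i x)\<^sup>2)" for i
    unfolding Y'_def[abs_def] power2_diff using Y iY by auto
  have int: "integrable M (\<lambda>x. X' i x * Y' j x)" for i j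
    by (intro integrable_mult_square X' Y')
  have "covariance M (\<lambda>x. \<Sum>i\<in>A. u i * X i x) (\<lambda>x. \<Sum>j\<in>B. v j * Y j x)
      = (\<integral>x. (\<Sum>i\<in>A. u i * X' i x) * (\<Sum>j\<in>B. v j * Y' j x) \<partial>M)"
    using iX iY by (simp add: covariance_def X'_def Y'_def right_diff_distrib sum_subtractf)
  also have "\<dots> = (\<integral>x. (\<Sum>i\<in>A. \<Sum>j\<in>B. u i * v j * (X' i x * Y' j x)) \<partial>M)"
    unfolding sum_product by (simp only: mult_ac)
  also have "\<dots> = (\<Sum>i\<in>A. \<Sum>j\<in>B. u i * v j * (\<integral>x. X' i x * Y' j x \<partial>M))"
    using int by simp
  finally show ?thesis by (simp add: covariance_def X'_def Y'_def)
qed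

lemma covariance_block_comb:
  assumes st: "second_order_stationary M Z"
  shows "covariance M (block_comb Z s b u) (block_comb Z s' b v)
    = (\<Sum>i<b. \<Sum>j<b. vec_index u i * vec_index v j * autocov M Z (s' + int j - (s + int i)))"
proof -
  have comm: "covariance M X Y = covariance M Y X" for X Y
    by (simp add: covariance_def mult.commute)
  \<comment> \<open>\<open>autocov\<close> takes the first index minus the second as its lag;
    symmetry of covariance reverses this.\<close>
  have cov: "covariance M (Z m) (Z n) = autocov M Z (n - m)" for m n
    using st comm[of "Z m" "Z n"] unfolding second_order_stationary_def
    by (metis add.commute diff_add_cancel)
  show ?thesis
    unfolding block_comb_def[abs_def]
    using st by (subst covariance_sum) (auto simp: second_order_stationary_def cov)
qed

text \<open>The common recursion settles nonnegative lags, and evenness settles the others.\<close>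

lemma autocov_eq_frac_cov:
  assumes d: "0 < d" "d < 1 / 2" and st: "second_order_stationary M Z"
    and sd: "spectral_density M Z (\<lambda>t. sigma2 * frac_density d t)"
  shows "autocov M Z n = autocov M Z 0 / frac_cov d 0 * frac_cov d (nat \<bar>n\<bar>)"
proof -
  \<comment> \<open>Stationarity shifts the pair of times \<open>0\<close> and \<open>- n\<close> by
    \<open>n\<close>; symmetry of covariance does the rest.\<close>
  have "autocov M Z (- n) = autocov M Z n"
    using st unfolding second_order_stationary_def autocov_def covariance_def
    by (metis (no_types, lifting) add.commute add.right_inverse mult.commute Bochner_Integration.integral_cong)
  then have abs: "autocov M Z n = autocov M Z (int (nat \<bar>n\<bar>))"
    by (cases "n \<ge> 0") auto
  have "autocov M Z (int m) * frac_cov d 0 = autocov M Z (int 0) * frac_cov d m" for m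
    using autocov_frac_recursion[OF d(2) sd] by (rule proportional_to_frac_cov[OF d])
  from this[of "nat \<bar>n\<bar>"] show ?thesis
    using frac_cov_0_ge_1[OF d] unfolding abs by (simp add: field_simps)
qed

text \<open>The scale \<open>q\<close> cancels between the covariance and the two standard
  deviations, which leaves a bound in \<open>d\<close>, \<open>b\<close> and \<open>k\<close>
  alone.\<close>

lemma correlation_block_comb_le:
  assumes d: "0 < d" "d < 1 / 2" and st: "second_order_stationary M Z"
    and sd: "spectral_density M Z (\<lambda>t. sigma2 * frac_density d t)"
    and bk: "b < k"
  shows "correlation M (block_comb Z 0 b u) (block_comb Z (int k) b v)
    \<le> (2 + 2 / (1 - 2 * d)) * frac_cov d 0 * (real b / (real k - real b)) powr (1 - 2 * d)"
proof -
  define q where "q = autocov M Z 0 / frac_cov d 0"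
  define C where "C = (2 + 2 / (1 - 2 * d)) * frac_cov d 0 * (real b / (real k - real b)) powr (1 - 2 * d)"
  have q: "q \<ge> 0"
    using frac_cov_nonneg[OF d, of 0] by (simp add: q_def autocov_def covariance_def)
  have C: "C \<ge> 0" using frac_cov_nonneg[OF d, of 0] d by (simp add: C_def)
  note autocov = autocov_eq_frac_cov[OF d st sd, folded q_def]
  have var: "covariance M (block_comb Z s b w) (block_comb Z s b w) = q * cov_form d b (vec_index w)" for s w
    unfolding covariance_block_comb[OF st] cov_form_def sum_distrib_left
    by (intro sum.cong refl, subst autocov) (simp add: abs_minus_commute)
  have "covariance M (block_comb Z 0 b u) (block_comb Z (int k) b v)
      = q * (\<Sum>i<b. \<Sum>j<b. vec_index u i * vec_index v j * frac_cov d (k + j - i))"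
    unfolding covariance_block_comb[OF st] sum_distrib_left
  proof (intro sum.cong refl)
    fix i j assume "i \<in> {..<b}"
    then have "nat \<bar>int k + int j - (0 + int i)\<bar> = k + j - i" using bk by auto
    then show "vec_index u i * vec_index v j * autocov M Z (int k + int j - (0 + int i))
        = q * (vec_index u i * vec_index v j * frac_cov d (k + j - i))"
      by (simp only: autocov mult_ac)
  qed
  also have "\<dots> \<le> q * (C * (sqrt (cov_form d b (vec_index u)) * sqrt (cov_form d b (vec_index v))))"
    using cross_form_bound[OF d bk, of "vec_index u" "vec_index v"] q
    unfolding C_def by (intro mult_left_mono) auto
  also have "\<dots> = C * (sqrt (q * cov_form d b (vec_index u)) * sqrt (q * cov_form d b (vec_index v)))"
    using q by (simp add: real_sqrt_mult)
  finally have le: "covariance M (block_comb Z 0 b u) (block_comb Z (int k) b v)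
    \<le> C * (sqrt (q * cov_form d b (vec_index u)) * sqrt (q * cov_form d b (vec_index v)))" .
  \<comment> \<open>If a block combination has zero variance, the quotient is \<open>0\<close> by
    convention, hence at most \<open>C\<close>.\<close>
  have div_le: "x / y \<le> C" if "x \<le> C * y" "0 \<le> y" for x y
    using that C by (cases "y = 0") (auto simp: pos_divide_le_eq)
  show ?thesis
    unfolding correlation_def var C_def[symmetric]
    using q cov_form_nonneg[OF d] by (intro div_le le) simp
qed

theorem theorem3p1:
  fixes M :: "'a measure" and Z :: "int \<Rightarrow> 'a \<Rightarrow> real" and d sigma2 :: real
  assumes "0 < d" and "d < 1 / 2" and "0 < sigma2"
    and "second_order_stationary M Z"
    and "\<And>b. b \<ge> 1 \<Longrightarrow> invertible_mat (cov_mat M Z b)"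
    and "spectral_density M Z (\<lambda>t. sigma2 * frac_density d t)"
  shows "\<exists>c>0. \<forall>b k :: nat. 1 \<le> b \<and> b < k \<longrightarrow>
           canonical_corr M Z k b \<le> c * (real b / (real k - real b)) powr (1 - 2 * d)"
proof (intro exI conjI allI impI)
  show "0 < (2 + 2 / (1 - 2 * d)) * frac_cov d 0"
    using assms(1,2) frac_cov_0_ge_1[of d] by (intro mult_pos_pos add_pos_pos) auto
next
  fix b k :: nat assume bk: "1 \<le> b \<and> b < k"
  \<comment> \<open>\<open>cSup_least\<close> demands a nonempty set; this vector serves as both
    \<open>u\<close> and \<open>v\<close>.\<close>
  have "unit_vec b 0 \<in> carrier_vec b \<and> unit_vec b 0 \<noteq> (0\<^sub>v b :: real Matrix.vec)"
    using bk by auto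
  then have "\<exists>x. x \<in> {correlation M (block_comb Z 0 b u) (block_comb Z (int k) b v) | u v.
      u \<in> carrier_vec b \<and> u \<noteq> 0\<^sub>v b \<and> v \<in> carrier_vec b \<and> v \<noteq> 0\<^sub>v b}"
    by blast
  then show "canonical_corr M Z k b
      \<le> (2 + 2 / (1 - 2 * d)) * frac_cov d 0 * (real b / (real k - real b)) powr (1 - 2 * d)"
    unfolding canonical_corr_def using correlation_block_comb_le[OF assms(1,2,4,6)] bk
    by (intro cSup_least) auto
qed

end
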